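(* Let $f:\mathbb{R}^n\to\mathbb{R}$ be a piecewise linear-quadratic (PLQ) function with polyhedral pieces $\{P^i\}_{i=1}^I$ (whose union is $\mathbb{R}^n$) and associated quadratic functions $\{q_i\}_{i=1}^I$, so that $f(x)=q_i(x)$ for all $x\in P^i$. Let $X\subseteq\mathbb{R}^n$ be a polyhedral set and let $\widetilde P^i\triangleq X\cap P^i$. Let $\bar x\in X$ and let $\mathcal{A}(\bar x)=\{i : \bar x\in P^i\}$. The following four statements are equivalent: (a1) $\bar x$ is a local minimizer of $f$ on $X$; (a2) for every $i\in\mathcal{A}(\bar x)$, $\bar x$ is a local minimizer of $q_i$ on $\widetilde P^i$; (b1) $\bar x$ is a directional stationary point of the problem of minimizing $f$ over $X$ and satisfies the second-order necessary condition, i.e., $f'(\bar x;v)\ge 0$ for all $v\in\mathcal{T}(\bar x;X)$, and $f^{(2)}(\bar x;v)\ge 0$ for all $v\in\mathcal{T}(\bar x;X)$ such that $f'(\bar x;v)=0$; (b2) for every $i\in\mathcal{A}(\bar x)$, $\bar x$ is a stationary point of $f$ (or equivalently, of $q_i$) on $\widetilde P^i$, and $\nabla^2 q_i(\bar x)$ is copositive on $\mathcal{C}(\bar x;q_i;\widetilde P^i)$.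
   Context: A continuous function $f:\mathcal{D}\to\mathbb{R}$, $\mathcal{D}\subseteq\mathbb{R}^n$, is piecewise linear-quadratic (PLQ) if there are finitely many quadratic functions $q_1,\dots,q_I$ (polynomials of degree at most 2) and polyhedra $P^1,\dots,P^I$ with union $\mathcal{D}$ such that $f=q_i$ on $P^i$. For a closed set $S$ and $\bar x\in S$, the tangent cone $\mathcal{T}(\bar x;S)$ is the set of all $v=\lim_k (x^k-\bar x)/\tau_k$ with $x^k\in S$, $x^k\to\bar x$, $\tau_k\downarrow 0$. One-sided directional derivatives: $f'(x;v)=\lim_{\tau\downarrow0}\frac{f(x+\tau v)-f(x)}{\tau}$ and $\tfrac12 f^{(2)}(x;v)=\lim_{\tau\downarrow 0}\frac{f(x+\tau v)-f(x)-\tau f'(x;v)}{\tau^2}$. For a PLQ function on $\mathbb{R}^n$ both exist for all $x,v$. A point $\bar x$ of a polyhedron $P$ is a (directional) stationary point of $g$ on $P$ if $g'(\bar x;v)\ge0$ for all $v\in\mathcal{T}(\bar x;P)$. It is a local minimizer of $g$ on $P$ if there is a neighborhood $\mathcal N$ of $\bar x$ with $g(x)\ge g(\bar x)$ for all $x\in P\cap\mathcal N$. For a quadratic function $q$, a polyhedron $P$ and $\bar x\in P$, the critical cone is $\mathcal{C}(\bar x;q;P)=\{v\in\mathcal{T}(\bar x;P): \nabla q(\bar x)^Tv=0\}$. A symmetric matrix $M$ is copositive on a cone $C$ if $v^TMv\ge0$ for all $v\in C$. *)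

theory Defs
  imports "HOL-Analysis.Analysis"
begin

definition quadratic_fun :: "(real^'n \<Rightarrow> real) \<Rightarrow> bool" where
  "quadratic_fun q \<longleftrightarrow>
     (\<exists>(A::real^'n^'n) b c. \<forall>x. q x = x \<bullet> (A *v x) + b \<bullet> x + c)"

definition plq_on ::
  "(real^'n) set \<Rightarrow> (real^'n \<Rightarrow> real) \<Rightarrow> nat \<Rightarrow> (nat \<Rightarrow> (real^'n) set)
    \<Rightarrow> (nat \<Rightarrow> real^'n \<Rightarrow> real) \<Rightarrow> bool" where
  "plq_on D f m P q \<longleftrightarrow>
     continuous_on D f \<and>
     (\<forall>i\<in>{1..m}. polyhedron (P i) \<and> quadratic_fun (q i)) \<and>
     (\<Union>i\<in>{1..m}. P i) = D \<and>
     (\<forall>i\<in>{1..m}. \<forall>x\<in>P i. f x = q i x)"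

definition active_pieces ::
  "nat \<Rightarrow> (nat \<Rightarrow> (real^'n) set) \<Rightarrow> real^'n \<Rightarrow> nat set" where
  "active_pieces m P x = {i \<in> {1..m}. x \<in> P i}"

definition tangent_cone :: "real^'n \<Rightarrow> (real^'n) set \<Rightarrow> (real^'n) set" where
  "tangent_cone x S =
     {v. \<exists>(y::nat \<Rightarrow> real^'n) \<tau>::nat \<Rightarrow> real.
           (\<forall>k. y k \<in> S) \<and> y \<longlonglongrightarrow> x \<and>
           (\<forall>k. \<tau> k > 0) \<and> \<tau> \<longlonglongrightarrow> 0 \<and>
           (\<lambda>k. (y k - x) /\<^sub>R \<tau> k) \<longlonglongrightarrow> v}"

(* Lim is a description operator: the next two values are unspecified if the limit
   does not exist. For piecewise linear-quadratic functions both limits always exist. *)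

definition dir_deriv :: "(real^'n \<Rightarrow> real) \<Rightarrow> real^'n \<Rightarrow> real^'n \<Rightarrow> real" where
  "dir_deriv f x v = Lim (at_right 0) (\<lambda>\<tau>. (f (x + \<tau> *\<^sub>R v) - f x) / \<tau>)"

(* The limit of the second-order quotient is one half of the second directional derivative. *)
definition dir_deriv2 :: "(real^'n \<Rightarrow> real) \<Rightarrow> real^'n \<Rightarrow> real^'n \<Rightarrow> real" where
  "dir_deriv2 f x v =
     2 * Lim (at_right 0)
           (\<lambda>\<tau>. (f (x + \<tau> *\<^sub>R v) - f x - \<tau> * dir_deriv f x v) / \<tau>\<^sup>2)"

definition dir_stationary ::
  "(real^'n \<Rightarrow> real) \<Rightarrow> (real^'n) set \<Rightarrow> real^'n \<Rightarrow> bool" where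
  "dir_stationary g S x \<longleftrightarrow> x \<in> S \<and> (\<forall>v\<in>tangent_cone x S. dir_deriv g x v \<ge> 0)"

definition second_order_necessary ::
  "(real^'n \<Rightarrow> real) \<Rightarrow> (real^'n) set \<Rightarrow> real^'n \<Rightarrow> bool" where
  "second_order_necessary g S x \<longleftrightarrow>
     (\<forall>v\<in>tangent_cone x S. dir_deriv g x v = 0 \<longrightarrow> dir_deriv2 g x v \<ge> 0)"

definition local_minimizer ::
  "(real^'n \<Rightarrow> real) \<Rightarrow> (real^'n) set \<Rightarrow> real^'n \<Rightarrow> bool" where
  "local_minimizer g S x \<longleftrightarrow>
     x \<in> S \<and> (\<exists>N. open N \<and> x \<in> N \<and> (\<forall>y\<in>S \<inter> N. g y \<ge> g x))"

definition gradient :: "(real^'n \<Rightarrow> real) \<Rightarrow> real^'n \<Rightarrow> real^'n" where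
  "gradient g x = (THE D. GDERIV g x :> D)"

definition hessian :: "(real^'n \<Rightarrow> real) \<Rightarrow> real^'n \<Rightarrow> real^'n^'n" where
  "hessian g x = jacobian (gradient g) (at x)"

definition critical_cone ::
  "real^'n \<Rightarrow> (real^'n \<Rightarrow> real) \<Rightarrow> (real^'n) set \<Rightarrow> (real^'n) set" where
  "critical_cone x q S = {v \<in> tangent_cone x S. gradient q x \<bullet> v = 0}"

(* Meant for symmetric M, which Hessians of quadratic functions are. *)
definition copositive_on :: "real^'n^'n \<Rightarrow> (real^'n) set \<Rightarrow> bool" where
  "copositive_on M C \<longleftrightarrow> (\<forall>v\<in>C. v \<bullet> (M *v v) \<ge> 0)"

end

(* A tangent vector of a polyhedron is a direction along which one can actually move, so along it
   a PLQ function agrees near the base point with the quadratic of a single piece; this reduces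
   everything to one quadratic q on one polyhedron S. For sufficiency of the second-order
   condition there, cut S down to a polytope. Stationarity says that x minimizes the linear
   function grad q(x) over S, and linear programs have weak sharp minima: y in S lies within
   C * grad q(x).(y - x) of a point z of S with grad q(x).(z - x) = 0. Copositivity makes the
   quadratic term nonnegative at z - x, and replacing z by y costs at most a constant times
   norm (y - x) * grad q(x).(y - x), which the first-order term absorbs near x. *)
theory Submission
  imports Defs
begin

section \<open>Derivatives and exact expansion of a quadratic function\<close>

lemma quadratic_fun_second_derivatives:
  fixes q :: "real^'n \<Rightarrow> real"
  assumes "quadratic_fun q"
  obtains A b c where "\<And>x. q x = x \<bullet> (A *v x) + b \<bullet> x + c"
    and "\<And>x. gradient q x = (A + transpose A) *v x + b"
    and "\<And>x. hessian q x = A + transpose A"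
proof -
  obtain A b c where q: "\<And>x. q x = x \<bullet> (A *v x) + b \<bullet> x + c"
    using assms unfolding quadratic_fun_def by blast
  have lin: "((*v) B has_derivative (*v) B) F" for B :: "real^'n^'n" and F
    by (rule bounded_linear_imp_has_derivative) (rule matrix_vector_mul_bounded_linear)
  have G: "GDERIV q x :> (A + transpose A) *v x + b" for x
  proof -
    have "(q has_derivative (\<lambda>h. x \<bullet> (A *v h) + h \<bullet> (A *v x) + b \<bullet> h)) (at x)"
      unfolding q by (auto intro!: derivative_eq_intros lin)
    moreover have "x \<bullet> (A *v h) + h \<bullet> (A *v x) + b \<bullet> h = h \<bullet> ((A + transpose A) *v x + b)" for h
      by (simp add: matrix_vector_mult_add_rdistrib inner_add_right inner_commute
          flip: dot_lmul_matrix)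
    ultimately show ?thesis
      unfolding gderiv_def by simp
  qed
  \<comment> \<open>\<open>gradient\<close> is a definite description, so the derivative
    \<open>G\<close> has to be shown unique before it can be named.\<close>
  have grad: "gradient q x = (A + transpose A) *v x + b" for x
    unfolding gradient_def
  proof (rule the_equality)
    show "GDERIV q x :> (A + transpose A) *v x + b"
      by (rule G)
    fix D assume "GDERIV q x :> D"
    then have "(\<lambda>h. h \<bullet> D) = (\<lambda>h. h \<bullet> ((A + transpose A) *v x + b))"
      using G has_derivative_unique unfolding gderiv_def by blast
    then show "D = (A + transpose A) *v x + b"
      by (metis vector_eq_ldot)
  qed
  have "(gradient q has_derivative (*v) (A + transpose A)) (at x)" for x
    unfolding grad by (auto intro!: derivative_eq_intros lin)
  then have "hessian q x = A + transpose A" for x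
    unfolding hessian_def jacobian_def
    by (metis frechet_derivative_at matrix_of_matrix_vector_mul)
  with q grad that show thesis by blast
qed

lemma quadratic_fun_expansion:
  fixes q :: "real^'n \<Rightarrow> real"
  assumes "quadratic_fun q"
  shows "q (x + v) = q x + gradient q x \<bullet> v + (v \<bullet> (hessian q x *v v)) / 2"
proof -
  obtain A b c where "\<And>x. q x = x \<bullet> (A *v x) + b \<bullet> x + c"
    and "\<And>x. gradient q x = (A + transpose A) *v x + b"
    and "\<And>x. hessian q x = A + transpose A"
    using quadratic_fun_second_derivatives assms by blast
  \<comment> \<open>\<open>A\<close> need not be symmetric. This swap matches the two cross terms of
    \<open>q (x + v)\<close> with the gradient term, and it makes half the Hessian form equal to the
    form of \<open>A\<close>.\<close>
  moreover have "v \<bullet> (transpose A *v w) = w \<bullet> (A *v v)" for v w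
    by (metis dot_lmul_matrix inner_commute transpose_matrix_vector)
  ultimately show ?thesis
    by (simp add: matrix_vector_mult_add_rdistrib matrix_vector_right_distrib inner_add_left
        inner_add_right inner_commute)
qed

section \<open>Tangent cones of polyhedra as sets of feasible directions\<close>

lemma eventually_ray_segment:
  fixes S :: "'a::real_vector set"
  assumes "convex S" "x \<in> S" "x + s *\<^sub>R v \<in> S" "0 < s"
  shows "\<forall>\<^sub>F t in at_right 0. x + t *\<^sub>R v \<in> S"
proof -
  have "x + t *\<^sub>R v \<in> S" if "0 < t" "t < s" for t
  proof -
    have "(1 - t / s) *\<^sub>R x + (t / s) *\<^sub>R (x + s *\<^sub>R v) \<in> S"
      using assms that by (intro convexD) auto
    moreover have "(1 - t / s) *\<^sub>R x + (t / s) *\<^sub>R (x + s *\<^sub>R v) = x + t *\<^sub>R v"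
      using \<open>0 < s\<close> by (simp add: algebra_simps)
    ultimately show ?thesis by simp
  qed
  then show ?thesis
    unfolding eventually_at_right_field using \<open>0 < s\<close> by blast
qed

lemma tendsto_ray: "((\<lambda>t::real. x + t *\<^sub>R v) \<longlongrightarrow> x) (at_right 0)"
  for x v :: "'a::real_normed_vector"
  by (auto intro!: tendsto_eq_intros)

lemma tangent_cone_mono: "S \<subseteq> T \<Longrightarrow> tangent_cone x S \<subseteq> tangent_cone x T"
  unfolding tangent_cone_def by blast

lemma tangent_cone_ray:
  assumes "\<forall>\<^sub>F t in at_right 0. x + t *\<^sub>R v \<in> S"
  shows "v \<in> tangent_cone x S"
proof -
  obtain d where d: "0 < d" "\<And>t. 0 < t \<Longrightarrow> t < d \<Longrightarrow> x + t *\<^sub>R v \<in> S"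
    using assms unfolding eventually_at_right_field by auto
  \<comment> \<open>The shift by 2 keeps every step strictly below \<open>d\<close>; a shift by 1
    would give exactly \<open>d\<close> at \<open>k = 0\<close>.\<close>
  define \<tau> where "\<tau> k = d / real (k + 2)" for k
  have pos: "\<tau> k > 0" for k
    using d(1) by (simp add: \<tau>_def)
  have "\<tau> k < d" for k
    using d(1) by (simp add: \<tau>_def field_simps add_pos_nonneg)
  moreover have lim: "\<tau> \<longlonglongrightarrow> 0"
    unfolding \<tau>_def by (intro LIMSEQ_ignore_initial_segment lim_const_over_n)
  moreover have "(\<lambda>k. x + \<tau> k *\<^sub>R v) \<longlonglongrightarrow> x"
    by (auto intro!: tendsto_eq_intros lim)
  moreover have "(x + \<tau> k *\<^sub>R v - x) /\<^sub>R \<tau> k = v" for k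
    using pos[of k] by simp
  ultimately show ?thesis
    unfolding tangent_cone_def using pos d(2)
    by (intro CollectI exI[of _ "\<lambda>k. x + \<tau> k *\<^sub>R v"] exI[of _ \<tau>]) auto
qed

lemma tangent_cone_convex:
  assumes "convex S" "x \<in> S" "y \<in> S"
  shows "y - x \<in> tangent_cone x S"
  using eventually_ray_segment[of S x 1 "y - x"] assms by (intro tangent_cone_ray) auto

text \<open>If the constraint is tight at \<open>x\<close>, every difference quotient has
  nonpositive inner product with \<open>a\<close>, and this survives in the limit \<open>v\<close>.
  If it is slack, continuity keeps it slack on a short ray, whatever \<open>v\<close> is.\<close>

lemma tangent_cone_halfspace_ray:
  assumes "a \<bullet> x \<le> b" "v \<in> tangent_cone x {y. a \<bullet> y \<le> b}"
  shows "\<forall>\<^sub>F t in at_right 0. a \<bullet> (x + t *\<^sub>R v) \<le> b"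
proof (cases "a \<bullet> x = b")
  case True
  obtain y \<tau> where y: "\<And>k::nat. a \<bullet> y k \<le> b" "\<And>k. \<tau> k > 0"
      "(\<lambda>k. (y k - x) /\<^sub>R \<tau> k) \<longlonglongrightarrow> v"
    using assms(2) unfolding tangent_cone_def by blast
  have "a \<bullet> ((y k - x) /\<^sub>R \<tau> k) \<le> 0" for k
    using y(1)[of k] y(2)[of k] True by (simp add: inner_diff_right mult_le_0_iff)
  moreover have "(\<lambda>k. a \<bullet> ((y k - x) /\<^sub>R \<tau> k)) \<longlonglongrightarrow> a \<bullet> v"
    by (intro tendsto_intros y(3))
  ultimately have "a \<bullet> v \<le> 0"
    by (meson LIMSEQ_le_const2)
  then have "a \<bullet> (x + t *\<^sub>R v) \<le> b" if "0 < t" for t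
    using that True by (simp add: inner_add_right mult_le_0_iff)
  then show ?thesis
    by (auto intro: eventually_mono[OF eventually_at_right_less])
next
  case False
  have "((\<lambda>t. a \<bullet> (x + t *\<^sub>R v)) \<longlongrightarrow> a \<bullet> x) (at_right 0)"
    by (intro tendsto_intros tendsto_ray)
  then show ?thesis
    using order_tendstoD(2)[of _ "a \<bullet> x" _ b] False assms(1)
    by (fastforce elim: eventually_mono)
qed

text \<open>Finiteness of the family of halfspaces is what makes the short rays found for the single
  constraints yield a common one. For a general closed convex set this fails: a ray tangent to a
  disc leaves it at once.\<close>

lemma tangent_cone_polyhedron_iff:
  assumes "polyhedron S" "x \<in> S"
  shows "v \<in> tangent_cone x S \<longleftrightarrow> (\<forall>\<^sub>F t in at_right 0. x + t *\<^sub>R v \<in> S)"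
proof
  assume v: "v \<in> tangent_cone x S"
  obtain F where F: "finite F" "S = \<Inter>F" "\<And>h. h \<in> F \<Longrightarrow> \<exists>a b. h = {y. a \<bullet> y \<le> b}"
    using assms(1) unfolding polyhedron_def by metis
  have "\<forall>\<^sub>F t in at_right 0. x + t *\<^sub>R v \<in> h" if "h \<in> F" for h
  proof -
    obtain a b where h: "h = {y. a \<bullet> y \<le> b}"
      using F(3) \<open>h \<in> F\<close> by blast
    have "S \<subseteq> h"
      using F(2) that by blast
    then have "x \<in> h" "v \<in> tangent_cone x h"
      using assms(2) v tangent_cone_mono[of S h] by auto
    then show ?thesis
      unfolding h using tangent_cone_halfspace_ray by simp
  qed
  then show "\<forall>\<^sub>F t in at_right 0. x + t *\<^sub>R v \<in> S"
    by (simp add: F(1,2) eventually_ball_finite_distrib)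
qed (rule tangent_cone_ray)

text \<open>A pigeonhole argument: the ray stays in \<open>X\<close> for small \<open>t\<close>, so
  one of the finitely many pieces is met for arbitrarily small \<open>t\<close>. Closedness puts
  \<open>x\<close> into that piece, and convexity upgrades "arbitrarily small" to "all sufficiently
  small".\<close>

lemma tangent_cone_finite_cover:
  assumes "polyhedron X" "x \<in> X" "finite I" "\<And>i. i \<in> I \<Longrightarrow> polyhedron (P i)"
    and cover: "X \<subseteq> (\<Union>i\<in>I. P i)" and "v \<in> tangent_cone x X"
  obtains i where "i \<in> I" "x \<in> P i" "v \<in> tangent_cone x (X \<inter> P i)"
proof -
  have X: "\<forall>\<^sub>F t in at_right 0. x + t *\<^sub>R v \<in> X"
    using assms tangent_cone_polyhedron_iff by blast
  then have "\<forall>\<^sub>F t in at_right 0. \<exists>i\<in>I. x + t *\<^sub>R v \<in> P i"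
    by (rule eventually_mono) (use cover in blast)
  then have "\<exists>\<^sub>F t in at_right (0::real). \<exists>i\<in>I. x + t *\<^sub>R v \<in> P i"
    by (intro eventually_frequently) simp
  then obtain i where i: "i \<in> I" "\<exists>\<^sub>F t in at_right 0. x + t *\<^sub>R v \<in> P i"
    using \<open>finite I\<close> by (auto simp: frequently_bex_finite_distrib)
  have Pi: "closed (P i)" "convex (P i)"
    using assms(4) i(1) by (simp_all add: polyhedron_imp_closed polyhedron_imp_convex)
  have "x \<in> P i"
  proof (rule ccontr)
    assume "x \<notin> P i"
    then have "\<forall>\<^sub>F t in at_right 0. x + t *\<^sub>R v \<in> - P i"
      using topological_tendstoD[OF tendsto_ray] Pi(1) by (metis ComplI open_Compl)
    then show False
      using i(2) by (simp add: frequently_def)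
  qed
  moreover have "\<exists>\<^sub>F t in at_right 0. x + t *\<^sub>R v \<in> P i \<and> 0 < t"
    using i(2) by (rule frequently_rev_mp) (auto intro: eventually_mono[OF eventually_at_right_less])
  then obtain s where "x + s *\<^sub>R v \<in> P i" "0 < s"
    using frequently_ex by blast
  ultimately have "\<forall>\<^sub>F t in at_right 0. x + t *\<^sub>R v \<in> P i"
    using Pi(2) by (intro eventually_ray_segment)
  then have "\<forall>\<^sub>F t in at_right 0. x + t *\<^sub>R v \<in> X \<inter> P i"
    using X by eventually_elim simp
  then show thesis
    using that i(1) \<open>x \<in> P i\<close> tangent_cone_ray by blast
qed

section \<open>Second-order sufficiency on a polytope\<close>

text \<open>Each generator of the polytope either minimizes the linear function already or exceeds
  the minimum by a positive gap, and in the second case it can be moved to \<open>x\<close> at a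
  cost proportional to the gap. Both the cost bound and the gap extend to convex
  combinations.\<close>

lemma polytope_weak_sharp_minimum:
  fixes S :: "'a::euclidean_space set"
  assumes "polytope S" "x \<in> S" and min: "\<And>y. y \<in> S \<Longrightarrow> g \<bullet> x \<le> g \<bullet> y"
  obtains C where "0 \<le> C"
    and "\<And>y. y \<in> S \<Longrightarrow> \<exists>z\<in>S. g \<bullet> z = g \<bullet> x \<and> norm (y - z) \<le> C * (g \<bullet> y - g \<bullet> x)"
proof -
  obtain U where U: "finite U" "S = convex hull U"
    using assms(1) unfolding polytope_def by blast
  have US: "U \<subseteq> S" and "convex S"
    using U(2) hull_subset[of U convex] by auto
  \<comment> \<open>The sum of nonnegative ratios dominates each one. Generators that attain the
    minimum contribute 0, since division by zero yields 0.\<close>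
  define C where "C = (\<Sum>u\<in>U. norm (u - x) / (g \<bullet> u - g \<bullet> x))"
  have pos: "0 \<le> norm (u - x) / (g \<bullet> u - g \<bullet> x)" if "u \<in> U" for u
    using min[of u] US that by auto
  define r where "r u = (if g \<bullet> u = g \<bullet> x then u else x)" for u
  have r: "r u \<in> S" "g \<bullet> r u = g \<bullet> x" "norm (u - r u) \<le> C * (g \<bullet> u - g \<bullet> x)" if "u \<in> U" for u
  proof -
    show "r u \<in> S" "g \<bullet> r u = g \<bullet> x"
      using that US \<open>x \<in> S\<close> by (auto simp: r_def)
    show "norm (u - r u) \<le> C * (g \<bullet> u - g \<bullet> x)"
    proof (cases "g \<bullet> u = g \<bullet> x")
      case False
      have "norm (u - x) / (g \<bullet> u - g \<bullet> x) \<le> C"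
        unfolding C_def using U(1) that pos by (intro member_le_sum) auto
      moreover have "g \<bullet> x < g \<bullet> u"
        using min[of u] US that False by fastforce
      ultimately show ?thesis
        using False by (simp add: r_def divide_le_eq)
    qed (simp add: r_def)
  qed
  show thesis
  proof
    show "0 \<le> C"
      unfolding C_def using pos by (rule sum_nonneg)
    fix y assume "y \<in> S"
    then obtain l where l: "\<And>u. u \<in> U \<Longrightarrow> 0 \<le> l u" "sum l U = 1" "y = (\<Sum>u\<in>U. l u *\<^sub>R u)"
      unfolding U(2) convex_hull_finite[OF U(1)] by blast
    \<comment> \<open>The weights of \<open>y\<close> are kept and only the generators are moved, so
      that \<open>y - z\<close> is the same combination of the displacements
      \<open>u - r u\<close>.\<close>
    define z where "z = (\<Sum>u\<in>U. l u *\<^sub>R r u)"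
    have "z \<in> S"
      unfolding z_def using U(1) \<open>convex S\<close> l r by (intro convex_sum) auto
    moreover have "g \<bullet> z = g \<bullet> x"
      using r(2) l(2) by (simp add: z_def inner_sum_right flip: sum_distrib_right)
    moreover have "norm (y - z) \<le> C * (g \<bullet> y - g \<bullet> x)"
    proof -
      have "norm (y - z) = norm (\<Sum>u\<in>U. l u *\<^sub>R (u - r u))"
        by (simp add: l(3) z_def sum_subtractf scaleR_diff_right)
      also have "\<dots> \<le> (\<Sum>u\<in>U. l u * (C * (g \<bullet> u - g \<bullet> x)))"
        using l(1) r(3) by (intro sum_norm_le) (simp add: mult_left_mono)
      also have "\<dots> = C * ((\<Sum>u\<in>U. l u * (g \<bullet> u)) - (\<Sum>u\<in>U. l u) * (g \<bullet> x))"
        by (simp add: sum_distrib_left sum_distrib_right sum_subtractf algebra_simps)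
      also have "\<dots> = C * (g \<bullet> y - g \<bullet> x)"
        by (simp add: l inner_sum_right)
      finally show ?thesis .
    qed
    ultimately show "\<exists>z\<in>S. g \<bullet> z = g \<bullet> x \<and> norm (y - z) \<le> C * (g \<bullet> y - g \<bullet> x)"
      by blast
  qed
qed

text \<open>The difference of the two forms splits into \<open>(v - w) \<bullet> (M *v v)\<close>
  and \<open>w \<bullet> (M *v (v - w))\<close>. Each is controlled by Cauchy-Schwarz and an
  operator bound \<open>K\<close>, so the error is of first order in \<open>v - w\<close>.\<close>

lemma quadratic_form_diff_bound:
  fixes M :: "real^'n^'n"
  obtains K where "0 < K"
    and "\<And>v w. w \<bullet> (M *v w) - K * norm (v - w) * (norm v + norm w) \<le> v \<bullet> (M *v v)"
proof -
  obtain K where K: "0 < K" "\<And>v. norm (M *v v) \<le> norm v * K"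
    using bounded_linear.pos_bounded[OF matrix_vector_mul_bounded_linear] by blast
  have bnd: "- (K * norm a * norm b) \<le> a \<bullet> (M *v b)" for a b
  proof -
    have "\<bar>a \<bullet> (M *v b)\<bar> \<le> norm a * (norm b * K)"
      by (meson Cauchy_Schwarz_ineq2 K(2) mult_left_mono norm_ge_zero order_trans)
    then show ?thesis
      by (simp add: mult_ac)
  qed
  show thesis
  proof (rule that[OF K(1)])
    fix v w
    have "v \<bullet> (M *v v) = w \<bullet> (M *v w) + (v - w) \<bullet> (M *v v) + w \<bullet> (M *v (v - w))"
      by (simp add: matrix_vector_mult_diff_distrib inner_diff_left inner_diff_right)
    then show "w \<bullet> (M *v w) - K * norm (v - w) * (norm v + norm w) \<le> v \<bullet> (M *v v)"
      using bnd[of "v - w" v] bnd[of w "v - w"] by (simp add: algebra_simps)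
  qed
qed

lemma local_minimizer_polytope_quadraticI:
  fixes q :: "real^'n \<Rightarrow> real"
  assumes "quadratic_fun q" "polytope S" "x \<in> S"
    and first: "\<And>y. y \<in> S \<Longrightarrow> 0 \<le> gradient q x \<bullet> (y - x)"
    and second: "\<And>y. y \<in> S \<Longrightarrow> gradient q x \<bullet> (y - x) = 0
                   \<Longrightarrow> 0 \<le> (y - x) \<bullet> (hessian q x *v (y - x))"
  shows "\<exists>d>0. \<forall>y\<in>S. dist y x < d \<longrightarrow> q x \<le> q y"
proof -
  define g H where "g = gradient q x" and "H = hessian q x"
  obtain C where C: "0 \<le> C"
    "\<And>y. y \<in> S \<Longrightarrow> \<exists>z\<in>S. g \<bullet> z = g \<bullet> x \<and> norm (y - z) \<le> C * (g \<bullet> y - g \<bullet> x)"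
    using polytope_weak_sharp_minimum[OF assms(2,3), of g] first
    by (auto simp: g_def inner_diff_right)
  obtain K where K: "0 < K"
    "\<And>v w. w \<bullet> (H *v w) - K * norm (v - w) * (norm v + norm w) \<le> v \<bullet> (H *v v)"
    using quadratic_form_diff_bound by metis
  \<comment> \<open>The factor in front of \<open>1\<close> comes from the bounds on
    \<open>norm (v - w)\<close> and \<open>norm v + norm w\<close> below. Adding 1 makes
    \<open>D\<close> positive, so that \<open>1 / D\<close> can serve as the radius.\<close>
  define D where "D = K * C * (2 + C * norm g) + 1"
  have D: "0 < D"
    using K(1) C(1) by (simp add: D_def add_nonneg_pos)
  have "q x \<le> q y" if y: "y \<in> S" "dist y x < 1 / D" for y
  proof -
    obtain z where z: "z \<in> S" "g \<bullet> z = g \<bullet> x" "norm (y - z) \<le> C * (g \<bullet> y - g \<bullet> x)"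
      using C(2) y(1) by blast
    define v w e where "v = y - x" and "w = z - x" and "e = g \<bullet> v"
    have e: "0 \<le> e" "norm (v - w) \<le> C * e" "e \<le> norm g * norm v"
      using first[OF y(1)] z(3) norm_cauchy_schwarz[of g v]
      by (auto simp: e_def v_def w_def g_def inner_diff_right)
    have "norm w \<le> norm v + norm (v - w)"
      by (metis norm_minus_commute norm_triangle_sub)
    also have "\<dots> \<le> norm v + C * (norm g * norm v)"
      using e(2,3) C(1) by (meson add_left_mono mult_left_mono order_trans)
    finally have w: "norm v + norm w \<le> (2 + C * norm g) * norm v"
      by (simp add: algebra_simps)
    have "K * norm (v - w) * (norm v + norm w) \<le> K * (C * e) * ((2 + C * norm g) * norm v)"
      using K(1) C(1) e w by (intro mult_mono) auto
    also have "\<dots> \<le> e * (D * norm v)"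
      using e(1) by (simp add: D_def algebra_simps)
    also have "\<dots> \<le> e * 1"
      using y(2) D e(1) by (intro mult_left_mono) (auto simp: v_def dist_norm field_simps)
    \<comment> \<open>The loss in the quadratic form is at most \<open>e\<close>. The form enters
      \<open>q y\<close> with factor 1/2, so at least half of the first-order gain \<open>e\<close>
      remains.\<close>
    finally have "w \<bullet> (H *v w) - e \<le> v \<bullet> (H *v v)"
      using K(2)[of w v] by linarith
    moreover have "0 \<le> w \<bullet> (H *v w)"
      using second[OF z(1)] z(2) by (simp add: w_def g_def H_def inner_diff_right)
    moreover have "q y = q x + e + (v \<bullet> (H *v v)) / 2"
      using quadratic_fun_expansion[OF assms(1), of x v] by (simp add: e_def g_def H_def v_def)
    ultimately show ?thesis
      using e(1) by linarith
  qed
  then show ?thesis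
    using D by (intro exI[of _ "1 / D"]) auto
qed

section \<open>Directional derivatives, and the criterion for one quadratic on one
  polyhedron\<close>

text \<open>Agreement on a short ray suffices, so this applies to \<open>f\<close> along a piece as
  well as to \<open>q\<close> itself. For small positive \<open>t\<close> the first quotient is
  affine in \<open>t\<close> and the second is constant, hence both limits exist and determine
  \<open>Lim\<close>.\<close>

lemma dir_derivs_along_quadratic:
  fixes q :: "real^'n \<Rightarrow> real"
  assumes "quadratic_fun q" "f x = q x" "\<forall>\<^sub>F t in at_right 0. f (x + t *\<^sub>R v) = q (x + t *\<^sub>R v)"
  shows "dir_deriv f x v = gradient q x \<bullet> v"
    and "dir_deriv2 f x v = v \<bullet> (hessian q x *v v)"
proof -
  have expand: "q (x + t *\<^sub>R v) = q x + t * (gradient q x \<bullet> v) + t\<^sup>2 * (v \<bullet> (hessian q x *v v)) / 2"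
    for t
    using quadratic_fun_expansion[OF assms(1), of x "t *\<^sub>R v"]
    by (simp add: matrix_vector_mult_scaleR power2_eq_square mult.assoc)
  have pos: "\<forall>\<^sub>F t in at_right (0::real). 0 < t"
    by (rule eventually_at_right_less)
  have "((\<lambda>t. gradient q x \<bullet> v + t * (v \<bullet> (hessian q x *v v)) / 2) \<longlongrightarrow> gradient q x \<bullet> v) (at_right 0)"
    by (auto intro!: tendsto_eq_intros)
  moreover have "\<forall>\<^sub>F t in at_right 0. gradient q x \<bullet> v + t * (v \<bullet> (hessian q x *v v)) / 2
                   = (f (x + t *\<^sub>R v) - f x) / t"
    using assms(3) pos by eventually_elim (simp add: assms(2) expand field_simps power2_eq_square)
  ultimately have "((\<lambda>t. (f (x + t *\<^sub>R v) - f x) / t) \<longlongrightarrow> gradient q x \<bullet> v) (at_right 0)"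
    by (rule Lim_transform_eventually)
  then show deriv: "dir_deriv f x v = gradient q x \<bullet> v"
    unfolding dir_deriv_def by (simp add: tendsto_Lim)
  have "\<forall>\<^sub>F t in at_right 0. v \<bullet> (hessian q x *v v) / 2
          = (f (x + t *\<^sub>R v) - f x - t * dir_deriv f x v) / t\<^sup>2"
    using assms(3) pos by eventually_elim (simp add: assms(2) expand deriv)
  then have "((\<lambda>t. (f (x + t *\<^sub>R v) - f x - t * dir_deriv f x v) / t\<^sup>2)
               \<longlongrightarrow> v \<bullet> (hessian q x *v v) / 2) (at_right 0)"
    by (rule Lim_transform_eventually[OF tendsto_const])
  then show "dir_deriv2 f x v = v \<bullet> (hessian q x *v v)"
    unfolding dir_deriv2_def by (simp add: tendsto_Lim)
qed

lemma local_minimizer_polyhedron_quadratic_iff: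
  fixes q :: "real^'n \<Rightarrow> real"
  assumes q: "quadratic_fun q" and S: "polyhedron S" "x \<in> S"
  shows "local_minimizer q S x \<longleftrightarrow>
    (\<forall>v\<in>tangent_cone x S. 0 \<le> gradient q x \<bullet> v \<and>
       (gradient q x \<bullet> v = 0 \<longrightarrow> 0 \<le> v \<bullet> (hessian q x *v v)))"
    (is "_ \<longleftrightarrow> ?second_order")
proof
  assume "local_minimizer q S x"
  then obtain N where N: "open N" "x \<in> N" "\<And>y. y \<in> S \<inter> N \<Longrightarrow> q x \<le> q y"
    unfolding local_minimizer_def by blast
  show ?second_order
  proof (intro ballI conjI impI)
    fix v assume v: "v \<in> tangent_cone x S"
    define a b where "a = gradient q x \<bullet> v" and "b = v \<bullet> (hessian q x *v v) / 2"
    have "\<forall>\<^sub>F t in at_right 0. x + t *\<^sub>R v \<in> S" "\<forall>\<^sub>F t in at_right 0. x + t *\<^sub>R v \<in> N"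
      using v S tangent_cone_polyhedron_iff topological_tendstoD[OF tendsto_ray N(1,2)] by auto
    \<comment> \<open>Along the ray the increment of \<open>q\<close> is
      \<open>t * (a + t * b)\<close>, and dividing by \<open>t > 0\<close> preserves its
      sign.\<close>
    then have ev: "\<forall>\<^sub>F t in at_right 0. 0 < t \<and> 0 \<le> a + t * b"
      using eventually_at_right_less[of 0]
    proof eventually_elim
      case (elim t)
      have "q (x + t *\<^sub>R v) = q x + t * (a + t * b)"
        using quadratic_fun_expansion[OF q, of x "t *\<^sub>R v"]
        by (simp add: a_def b_def matrix_vector_mult_scaleR algebra_simps)
      then show ?case
        using N(3)[of "x + t *\<^sub>R v"] elim by (simp add: zero_le_mult_iff)
    qed
    moreover have "((\<lambda>t. a + t * b) \<longlongrightarrow> a) (at_right 0)"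
      by (auto intro!: tendsto_eq_intros)
    ultimately show "0 \<le> gradient q x \<bullet> v"
      unfolding a_def[symmetric] by (elim tendsto_lowerbound) (auto elim: eventually_mono)
    \<comment> \<open>Once \<open>a\<close> vanishes, a single small \<open>t\<close> already
      decides the sign of \<open>b\<close>.\<close>
    assume "gradient q x \<bullet> v = 0"
    then obtain t where "0 < t" "0 \<le> t * b"
      using eventually_happens[OF ev] by (auto simp: a_def)
    then show "0 \<le> v \<bullet> (hessian q x *v v)"
      by (simp add: b_def zero_le_mult_iff)
  qed
next
  assume so: ?second_order
  \<comment> \<open>Intersecting with a box that contains the unit ball around \<open>x\<close>
    gives a polytope and loses no point of \<open>S\<close> within distance 1, whence the radius
    \<open>min d 1\<close> below.\<close>
  obtain r where r: "cball x 1 \<subseteq> cbox (- r) r"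
    using bounded_subset_cbox_symmetric[OF bounded_cball] by metis
  define B where "B = S \<inter> cbox (- r) r"
  have "polytope B"
    unfolding B_def using S(1) by (simp add: polyhedron_Int_polytope polytope_interval)
  moreover have "x \<in> B"
    using S(2) r by (auto simp: B_def)
  moreover have "y - x \<in> tangent_cone x S" if "y \<in> B" for y
    using that S by (simp add: B_def tangent_cone_convex polyhedron_imp_convex)
  ultimately obtain d where d: "d > 0" "\<And>y. y \<in> B \<Longrightarrow> dist y x < d \<Longrightarrow> q x \<le> q y"
    using local_minimizer_polytope_quadraticI[OF q] so by metis
  have "q x \<le> q y" if "y \<in> S \<inter> ball x (min d 1)" for y
  proof -
    have "y \<in> B"
      using that r by (auto simp: B_def)
    then show ?thesis
      using d(2) that by (simp add: dist_commute)
  qed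
  then show "local_minimizer q S x"
    unfolding local_minimizer_def using S(2) d(1)
    by (intro conjI exI[of _ "ball x (min d 1)"]) auto
qed

section \<open>From the pieces to the whole function\<close>

text \<open>A closed piece that misses \<open>x\<close> is avoided by a whole neighborhood of
  \<open>x\<close>, so it imposes no condition. Finitely many neighborhoods have an open
  intersection.\<close>

lemma local_minimizer_finite_cover:
  fixes f :: "real^'n \<Rightarrow> real"
  assumes "finite I" "\<And>i. i \<in> I \<Longrightarrow> closed (P i)" "X \<subseteq> (\<Union>i\<in>I. P i)" "x \<in> X"
    and loc: "\<And>i. i \<in> I \<Longrightarrow> x \<in> P i \<Longrightarrow> local_minimizer f (X \<inter> P i) x"
  shows "local_minimizer f X x"
proof -
  have "\<exists>N. open N \<and> x \<in> N \<and> (\<forall>y \<in> X \<inter> P i \<inter> N. f x \<le> f y)" if "i \<in> I" for i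
  proof (cases "x \<in> P i")
    case True
    then show ?thesis
      using loc that unfolding local_minimizer_def by blast
  next
    case False
    then show ?thesis
      using assms(2) that by (intro exI[of _ "- P i"]) auto
  qed
  then obtain N where N: "\<And>i. i \<in> I \<Longrightarrow> open (N i) \<and> x \<in> N i \<and> (\<forall>y \<in> X \<inter> P i \<inter> N i. f x \<le> f y)"
    by metis
  have "open (\<Inter>i\<in>I. N i)"
    using N \<open>finite I\<close> by (intro open_INT) auto
  moreover have "\<forall>y\<in>X \<inter> (\<Inter>i\<in>I. N i). f x \<le> f y"
    using N assms(3) by blast
  ultimately show ?thesis
    unfolding local_minimizer_def using N \<open>x \<in> X\<close> by blast
qed

theorem theorem2:
  fixes f :: "real^'n \<Rightarrow> real"
    and m :: nat
    and P :: "nat \<Rightarrow> (real^'n) set"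
    and q :: "nat \<Rightarrow> real^'n \<Rightarrow> real"
    and X :: "(real^'n) set"
    and x :: "real^'n"
  assumes "plq_on UNIV f m P q"
    and "polyhedron X"
    and "x \<in> X"
  shows
    "(local_minimizer f X x \<longleftrightarrow>
        (\<forall>i\<in>active_pieces m P x. local_minimizer (q i) (X \<inter> P i) x)) \<and>
     (local_minimizer f X x \<longleftrightarrow>
        dir_stationary f X x \<and> second_order_necessary f X x) \<and>
     (local_minimizer f X x \<longleftrightarrow>
        (\<forall>i\<in>active_pieces m P x.
           dir_stationary f (X \<inter> P i) x \<and>
           copositive_on (hessian (q i) x) (critical_cone x (q i) (X \<inter> P i)))) \<and>
     (\<forall>i\<in>active_pieces m P x.
        dir_stationary f (X \<inter> P i) x \<longleftrightarrow> dir_stationary (q i) (X \<inter> P i) x)"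
proof -
  have plq: "(\<Union>i\<in>{1..m}. P i) = UNIV" "\<And>i. i \<in> {1..m} \<Longrightarrow> polyhedron (P i)"
      "\<And>i. i \<in> {1..m} \<Longrightarrow> quadratic_fun (q i)" "\<And>i y. i \<in> {1..m} \<Longrightarrow> y \<in> P i \<Longrightarrow> f y = q i y"
    using assms(1) unfolding plq_on_def by auto
  let ?A = "active_pieces m P x"
  let ?T = "\<lambda>i. tangent_cone x (X \<inter> P i)"
  let ?g = "\<lambda>i. gradient (q i) x" and ?H = "\<lambda>i. hessian (q i) x"
  have active: "i \<in> {1..m}" "x \<in> P i" "polyhedron (X \<inter> P i)" "x \<in> X \<inter> P i" "quadratic_fun (q i)"
    if "i \<in> ?A" for i
    using that plq(2,3) assms(2,3) by (auto simp: active_pieces_def)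
  \<comment> \<open>These formulas are confined to directions tangent to the piece: there the ray
    stays in \<open>P i\<close> for small \<open>t\<close>, and \<open>f\<close> coincides with
    \<open>q i\<close> on it.\<close>
  have f_derivs: "dir_deriv f x v = ?g i \<bullet> v" "dir_deriv2 f x v = v \<bullet> (?H i *v v)"
    if "i \<in> ?A" "v \<in> ?T i" for i v
  proof -
    have "\<forall>\<^sub>F t in at_right 0. x + t *\<^sub>R v \<in> X \<inter> P i"
      using tangent_cone_polyhedron_iff[OF active(3,4)] that by blast
    then have "\<forall>\<^sub>F t in at_right 0. f (x + t *\<^sub>R v) = q i (x + t *\<^sub>R v)"
      by (rule eventually_mono) (use plq(4) active(1) that(1) in auto)
    then show "dir_deriv f x v = ?g i \<bullet> v" "dir_deriv2 f x v = v \<bullet> (?H i *v v)"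
      using dir_derivs_along_quadratic[of "q i" f x v] active that(1) plq(4) by auto
  qed
  have q_derivs: "dir_deriv (q i) x v = ?g i \<bullet> v" if "i \<in> ?A" for i v
    using dir_derivs_along_quadratic(1)[of "q i" "q i" x v] active that by simp
  \<comment> \<open>This identity splits any condition quantified over tangent directions of
    \<open>X\<close> into conditions on the active pieces.\<close>
  have tangent: "tangent_cone x X = (\<Union>i\<in>?A. ?T i)"
  proof (intro equalityI subsetI)
    fix v assume "v \<in> tangent_cone x X"
    then obtain i where "i \<in> {1..m}" "x \<in> P i" "v \<in> ?T i"
      using tangent_cone_finite_cover[of X x "{1..m}" P v] assms(2,3) plq(1,2) by auto
    then show "v \<in> (\<Union>i\<in>?A. ?T i)"
      by (auto simp: active_pieces_def)
  next
    fix v assume "v \<in> (\<Union>i\<in>?A. ?T i)"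
    then show "v \<in> tangent_cone x X"
      using tangent_cone_mono[OF Int_lower1] by blast
  qed
  have stationary: "dir_stationary f (X \<inter> P i) x \<longleftrightarrow> (\<forall>v\<in>?T i. 0 \<le> ?g i \<bullet> v)"
      "dir_stationary (q i) (X \<inter> P i) x \<longleftrightarrow> (\<forall>v\<in>?T i. 0 \<le> ?g i \<bullet> v)" if "i \<in> ?A" for i
    unfolding dir_stationary_def using f_derivs(1) q_derivs active that by auto
  have piece: "local_minimizer (q i) (X \<inter> P i) x \<longleftrightarrow>
      (\<forall>v\<in>?T i. 0 \<le> ?g i \<bullet> v \<and> (?g i \<bullet> v = 0 \<longrightarrow> 0 \<le> v \<bullet> (?H i *v v)))" if "i \<in> ?A" for i
    using local_minimizer_polyhedron_quadratic_iff[OF active(5,3,4)] that by simp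
  have q_local: "local_minimizer (q i) (X \<inter> P i) x \<longleftrightarrow> local_minimizer f (X \<inter> P i) x"
    if "i \<in> ?A" for i
    unfolding local_minimizer_def using plq(4) active(1,2)[OF that] by auto
  have a: "local_minimizer f X x \<longleftrightarrow> (\<forall>i\<in>?A. local_minimizer (q i) (X \<inter> P i) x)"
  proof
    assume "local_minimizer f X x"
    then have "local_minimizer f (X \<inter> P i) x" if "i \<in> ?A" for i
      unfolding local_minimizer_def using active(2)[OF that] by blast
    then show "\<forall>i\<in>?A. local_minimizer (q i) (X \<inter> P i) x"
      using q_local by blast
  next
    assume "\<forall>i\<in>?A. local_minimizer (q i) (X \<inter> P i) x"
    then have "local_minimizer f (X \<inter> P i) x" if "i \<in> {1..m}" "x \<in> P i" for i
      using q_local that by (simp add: active_pieces_def)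
    then show "local_minimizer f X x"
      using local_minimizer_finite_cover[of "{1..m}" P X x f] plq(1,2) assms(3)
      by (simp add: polyhedron_imp_closed)
  qed
  \<comment> \<open>The criterion for \<open>q i\<close> is restated in terms of \<open>f\<close>
    alone, in which form it can be joined over all pieces by \<open>tangent\<close>.\<close>
  have f_second_order: "local_minimizer (q i) (X \<inter> P i) x \<longleftrightarrow>
      (\<forall>v\<in>?T i. 0 \<le> dir_deriv f x v \<and> (dir_deriv f x v = 0 \<longrightarrow> 0 \<le> dir_deriv2 f x v))"
    if "i \<in> ?A" for i
    unfolding piece[OF that] by (intro ball_cong) (simp_all add: f_derivs[OF that])
  have b1: "dir_stationary f X x \<and> second_order_necessary f X x \<longleftrightarrow>
      (\<forall>i\<in>?A. local_minimizer (q i) (X \<inter> P i) x)"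
    unfolding dir_stationary_def second_order_necessary_def tangent
    using assms(3) f_second_order by auto
  \<comment> \<open>The equivalence holds piece by piece: membership in the critical cone is exactly
    the premise under which \<open>piece\<close> asks for a nonnegative quadratic form.\<close>
  have b2: "dir_stationary f (X \<inter> P i) x \<and>
      copositive_on (?H i) (critical_cone x (q i) (X \<inter> P i)) \<longleftrightarrow>
      local_minimizer (q i) (X \<inter> P i) x" if "i \<in> ?A" for i
    unfolding stationary(1)[OF that] piece[OF that] copositive_on_def critical_cone_def by blast
  show ?thesis
    using a b1 b2 stationary by simp
qed

end
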